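(* Both the left-handed and the right-handed trefoil knots are tie knots.
   Context: Tie sequences. The tie moves are $L_i,L_o,R_i,R_o,C_i,C_o$; the letter names a region (left, right, center) and the subscript a direction ($i$ = in, $o$ = out). A tie sequence is a finite list of tie moves followed by the symbol $T$ (tuck) such that: it begins with $L_i$ or $L_o$; no two consecutive moves have the same letter; directions alternate between in and out; it ends with $L_oR_iC_oT$ or $R_oL_iC_oT$. There is no bound on the number of moves. Tie diagrams. In the plane, the passive strand starts at a point $b$ at the bottom, runs up the "straight strand" to a point $x$, then up the left side of the "neck loop", clockwise over its top, and down its right side to a point $a$ just to the right of $x$. The active strand starts at $a$; its first move (an $L$ move) carries it leftward across the passive strand at $x$, closing the neck loop (the first crossing, counted as the topmost crossing of the straight strand). $C$ is the region inside the neck loop; $L$ and $R$ are the regions outside it to the left and right of the straight strand (the active strand never passes above the neck loop). Each further move carries the active strand from its current region to the named region, crossing the passive strand exactly once: across the straight strand between $L$ and $R$, across the left side of the neck loop between $L$ and $C$, across the right side between $R$ and $C$. An in-move means the active strand crosses over, an out-move that it crosses under. Successive crossings on the straight strand are placed lower and lower, and successive crossings on each side of the neck loop are placed higher and higher (farther from the first crossing), so that these moves create no self-crossing of the active strand. Tuck: if the sequence ends with $R_oL_iC_oT$, let $\ell$ be the arc of the active strand in region $R$ between the crossings of the final $R_o$ and final $L_i$. After $C_o$ the active strand leaves $C$ passing over the right side of the neck loop, above all earlier crossings there (crossing $t_1$, an $R_i$ move), then crosses $\ell$ over (crossing $t_2$) and then under (crossing $t_3$), where $t_2$ precedes $t_3$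 along $\ell$ from $R_o$ to $L_i$, and then runs to $b$ with no further crossings. If the sequence ends with $L_oR_iC_oT$, interchange $L$ and $R$ in this description (so $t_1$ is an $L_i$ move). The resulting closed curve with crossing information is the tie diagram of the sequence. A tie knot is a knot in $\mathbb{R}^3$ equivalent (ambient isotopic) to the one given by the tie diagram of some tie sequence. *)

theory Defs
  imports "HOL-Analysis.Analysis"
begin

definition knot :: "(real^3) set \<Rightarrow> bool" where
  "knot K \<longleftrightarrow> K homeomorphic (sphere 0 1 :: complex set)"

definition ambient_isotopic :: "(real^3) set \<Rightarrow> (real^3) set \<Rightarrow> bool" where
  "ambient_isotopic K K' \<longleftrightarrow>
     (\<exists>h. homotopic_with_canon (\<lambda>f. \<exists>g. homeomorphism UNIV UNIV f g) UNIV UNIV id h \<and> h ` K = K')"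

definition closed_polygon :: "(real^3) list \<Rightarrow> (real^3) set" where
  "closed_polygon vs = (\<Union>i<length vs. closed_segment (vs ! i) (vs ! (Suc i mod length vs)))"

text \<open>A knot diagram with crossing information is turned into a knot in space by drawing it in the
  first two coordinates and using the third one as height towards the viewer.

  The standard three-crossing diagram of the trefoil, with all heights multiplied by \<open>h\<close>. The
  first, third and fifth edge project into the lines \<open>y = 0\<close>, \<open>x = 0\<close>, \<open>x + y = 3\<close> and meet
  pairwise at \<open>(0,0)\<close>, \<open>(3,0)\<close>, \<open>(0,3)\<close>; the other three edges have no crossings. Each of the
  three long edges runs from height \<open>h\<close> to \<open>-h\<close>, so for \<open>h = 1\<close> it crosses over first and
  under second: the diagram is alternating, and all three crossings are negative. For
  \<open>h = -1\<close> one gets the mirror image, with three positive crossings.\<close>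

definition trefoil :: "real \<Rightarrow> (real^3) set" where
  "trefoil h = closed_polygon
     [vector [-2, 0, h], vector [5, 0, -h], vector [0, 5, h],
      vector [0, -2, -h], vector [5, -2, h], vector [-2, 5, -h]]"

definition left_trefoil :: "(real^3) set" where
  "left_trefoil = trefoil 1"

definition right_trefoil :: "(real^3) set" where
  "right_trefoil = trefoil (-1)"

datatype region = Left | Right | Center
datatype direction = In | Out
type_synonym tie_move = "region \<times> direction"

text \<open>The tuck symbol that ends every tie sequence is left implicit: the list contains the moves only.\<close>

definition tie_sequence :: "tie_move list \<Rightarrow> bool" where
  "tie_sequence w \<longleftrightarrow>
     w \<noteq> [] \<and> fst (hd w) = Left \<and>
     (\<forall>k. Suc k < length w \<longrightarrow> fst (w ! k) \<noteq> fst (w ! Suc k) \<and> snd (w ! k) \<noteq> snd (w ! Suc k)) \<and>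
     (\<exists>u. w = u @ [(Left, Out), (Right, In), (Center, Out)] \<or>
          w = u @ [(Right, Out), (Left, In), (Center, Out)])"

text \<open>The passive strand is drawn at height 0, with \<open>x\<close> at the origin: the straight strand, the left
  side and the right side of the neck loop lie on the three rays from the origin spanned by
  \<open>(0,-1)\<close>, \<open>(-1,1)\<close>, \<open>(1,1)\<close>, which bound the three regions. \<open>border p q\<close> is the ray
  between the regions \<open>p\<close> and \<open>q\<close>, and \<open>middle q\<close> is half the sum of the two rays bounding \<open>q\<close>.\<close>

definition border :: "region \<Rightarrow> region \<Rightarrow> real^3" where
  "border p q = (if Center \<notin> {p, q} then vector [0, -1, 0]
                 else if Left \<in> {p, q} then vector [-1, 1, 0]
                 else vector [1, 1, 0])"

fun middle :: "region \<Rightarrow> real^3" where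
  "middle Left = vector [-1/2, 0, 0]"
| "middle Right = vector [1/2, 0, 0]"
| "middle Center = vector [0, 1, 0]"

definition up :: "real^3" where
  "up = vector [0, 0, 1]"

fun height :: "direction \<Rightarrow> real" where
  "height In = 1"
| "height Out = -1"

text \<open>The active strand starts just to the right of \<open>x\<close>, so the first move leads from right to left.\<close>

fun region_before :: "tie_move list \<Rightarrow> nat \<Rightarrow> region" where
  "region_before w 0 = Right"
| "region_before w (Suc k) = fst (w ! k)"

text \<open>Counting from 0, the crossing of move \<open>k\<close> is at parameter \<open>k\<close> of its ray, above or below
  the passive strand; afterwards the active strand turns inside the region it has entered. In the
  coordinates \<open>(s,t)\<close> given by the two rays bounding this region, the arc from crossing \<open>k\<close> to
  crossing \<open>k + 1\<close> satisfies \<open>k \<le> s + t \<le> k + 1\<close>. Consecutive arcs lie in different regions,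
  so the projections of these arcs do not meet, and crossings on each ray move away from \<open>x\<close>.\<close>

definition crossing :: "tie_move list \<Rightarrow> nat \<Rightarrow> real^3" where
  "crossing w k = real k *\<^sub>R border (region_before w k) (fst (w ! k)) + height (snd (w ! k)) *\<^sub>R up"

definition turn :: "tie_move list \<Rightarrow> nat \<Rightarrow> real^3" where
  "turn w k = (real k + 1/2) *\<^sub>R middle (fst (w ! k))"

text \<open>The vertices below are, in order: \<open>b\<close>, \<open>x\<close>, the two upper corners of the neck loop, \<open>a\<close>; then
  the crossings and turns of the moves; then the tuck. Its first crossing (\<open>t1\<close>) is that of an
  additional in-move back to the region of the third last move, above all crossings on that side.
  The arc \<open>l\<close> consists of the segments from \<open>p\<close> to \<open>m\<close> and from \<open>m\<close> to \<open>q\<close>. The strand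
  crosses over \<open>l\<close> (\<open>t2\<close>) at one third of the way from \<open>m\<close> to \<open>q\<close>, turns at the centroid of
  the triangle \<open>p m q\<close>, which contains no other part of the diagram, crosses under \<open>l\<close> (\<open>t3\<close>)
  at two thirds of the way from \<open>m\<close> to \<open>q\<close>, and closes up at \<open>b\<close>.\<close>

definition tie_vertices :: "tie_move list \<Rightarrow> (real^3) list" where
  "tie_vertices w =
     (let n = length w;
          w' = w @ [(fst (w ! (n - 3)), In)];
          p = crossing w (n - 3);
          m = turn w (n - 3);
          q = crossing w (n - 2)
      in [vector [0, - real n, 0],
          vector [0, 0, 0],
          vector [- real n - 1, real n + 1, 0],
          vector [real n + 1, real n + 1, 0],
          vector [1/2, 1/2, 0]]
         @ concat (map (\<lambda>k. [crossing w' k, turn w' k]) [0..<n])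
         @ [crossing w' n,
            (2/3) *\<^sub>R m + (1/3) *\<^sub>R q + up,
            (1/3) *\<^sub>R (p + m + q),
            (1/3) *\<^sub>R m + (2/3) *\<^sub>R q - up])"

definition tie_curve :: "tie_move list \<Rightarrow> (real^3) set" where
  "tie_curve w = closed_polygon (tie_vertices w)"

definition tie_knot :: "(real^3) set \<Rightarrow> bool" where
  "tie_knot K \<longleftrightarrow> knot K \<and> (\<exists>w. tie_sequence w \<and> ambient_isotopic K (tie_curve w))"

end

theory Submission
  imports Defs
begin

text \<open>The four-in-hand sequence \<open>L\<^sub>i R\<^sub>o L\<^sub>i C\<^sub>o T\<close> gives the left-handed trefoil and
  \<open>L\<^sub>o C\<^sub>i L\<^sub>o C\<^sub>i R\<^sub>o L\<^sub>i C\<^sub>o T\<close> the right-handed one. Each trefoil is carried to its tie curve by a short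
  chain of motions of a closed polygon in which all vertices move with constant velocity. If during
  such a motion any two edges are kept apart by a linear functional that does not depend on time,
  then distances along the polygon are bounded below by differences of displacements. Hence the
  motion is cut into small steps, each of which moves the points \<open>x\<close> of the polygon to
  \<open>x + F x\<close> with \<open>F\<close> of small Lipschitz constant. Such an \<open>F\<close> extends to the whole space, where
  \<open>x + t F x\<close> for \<open>0 \<le> t \<le> 1\<close> is an ambient isotopy. As vertices move linearly, separation
  needs to be checked at the vertices and at the two end times only, which is a finite computation
  with integers.\<close>

section \<open>Isotopies from Lipschitz displacements\<close>

text \<open>The infimum in the proof is McShane's extension.\<close>

lemma lipschitz_on_extend_real:
  fixes f :: "'a::metric_space \<Rightarrow> real"
  assumes f: "L-lipschitz_on E f"
  obtains g where "L-lipschitz_on UNIV g" "\<And>x. x \<in> E \<Longrightarrow> g x = f x"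
proof (cases "E = {}")
  case True
  have "L-lipschitz_on UNIV (\<lambda>x::'a. 0 :: real)"
    using lipschitz_on_nonneg[OF f] by (auto intro!: lipschitz_onI)
  with True that show thesis by blast
next
  case False
  have L: "0 \<le> L" by (rule lipschitz_on_nonneg[OF f])
  define g where "g x = (INF y\<in>E. f y + L * dist x y)" for x
  \<comment> \<open>This serves twice: it bounds the family in the infimum from below, and for
    \<open>z = x\<close> it gives \<open>f x \<le> g x\<close>.\<close>
  have low: "f z - L * dist x z \<le> f y + L * dist x y" if "y \<in> E" "z \<in> E" for x y z
  proof -
    have "f z - f y \<le> L * dist z y"
      using lipschitz_onD[OF f that(2,1)] by (simp add: dist_real_def)
    also have "\<dots> \<le> L * (dist x z + dist x y)"
      using L by (intro mult_left_mono) (metis dist_commute dist_triangle)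
    finally show ?thesis by (simp add: algebra_simps)
  qed
  have bdd: "bdd_below ((\<lambda>y. f y + L * dist x y) ` E)" for x
    using False low by (fastforce simp: bdd_below_def)
  have "g x = f x" if "x \<in> E" for x
  proof (rule antisym)
    show "g x \<le> f x"
      unfolding g_def by (rule cINF_lower2[OF bdd that]) simp
    show "f x \<le> g x"
      unfolding g_def using low[OF _ that, of _ x] by (intro cINF_greatest[OF False]) simp
  qed
  moreover have "g x - g y \<le> L * dist x y" for x y
  proof -
    have "g x - L * dist x y \<le> f z + L * dist y z" if "z \<in> E" for z
    proof -
      have "g x \<le> f z + L * dist x z"
        unfolding g_def by (rule cINF_lower[OF bdd that])
      also have "L * dist x z \<le> L * (dist x y + dist y z)"
        using L by (intro mult_left_mono dist_triangle)
      finally show ?thesis by (simp add: algebra_simps)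
    qed
    then have "g x - L * dist x y \<le> g y"
      unfolding g_def[of y] by (rule cINF_greatest[OF False])
    then show ?thesis by simp
  qed
  then have "L-lipschitz_on UNIV g"
    by (intro lipschitz_onI L) (fastforce simp: dist_real_def abs_le_iff dist_commute)
  ultimately show thesis using that by blast
qed

text \<open>Coordinates are extended one at a time and summed over the basis, which costs a factor
  of the dimension. The factor is harmless here, because the constant \<open>L\<close> can be made
  small by taking short time steps.\<close>

lemma lipschitz_on_extend:
  fixes f :: "'a::metric_space \<Rightarrow> 'b::euclidean_space"
  assumes f: "L-lipschitz_on E f"
  obtains g where "(real DIM('b) * L)-lipschitz_on UNIV g" "\<And>x. x \<in> E \<Longrightarrow> g x = f x"
proof -
  have "\<exists>g. L-lipschitz_on UNIV g \<and> (\<forall>x\<in>E. g x = f x \<bullet> b)" if "b \<in> Basis" for b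
  proof -
    have "\<bar>f x \<bullet> b - f y \<bullet> b\<bar> \<le> L * dist x y" if "x \<in> E" "y \<in> E" for x y
    proof -
      have "\<bar>f x \<bullet> b - f y \<bullet> b\<bar> \<le> norm (f x - f y)"
        using Basis_le_norm[OF \<open>b \<in> Basis\<close>, of "f x - f y"] by (simp add: inner_diff_left)
      also have "\<dots> \<le> L * dist x y"
        using lipschitz_onD[OF f that] by (simp add: dist_norm)
      finally show ?thesis .
    qed
    then have "L-lipschitz_on E (\<lambda>x. f x \<bullet> b)"
      using lipschitz_on_nonneg[OF f] by (intro lipschitz_onI) (auto simp: dist_real_def)
    then show ?thesis by (rule lipschitz_on_extend_real) blast
  qed
  then obtain g where g: "\<And>b. b \<in> Basis \<Longrightarrow> L-lipschitz_on UNIV (g b)"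
    and gf: "\<And>b x. b \<in> Basis \<Longrightarrow> x \<in> E \<Longrightarrow> g b x = f x \<bullet> b"
    by metis
  show thesis
  proof
    show "(\<Sum>b\<in>Basis. g b x *\<^sub>R b) = f x" if "x \<in> E" for x
      using gf that by (simp add: euclidean_representation)
    show "(real DIM('b) * L)-lipschitz_on UNIV (\<lambda>x. \<Sum>b\<in>Basis. g b x *\<^sub>R b)"
    proof (rule lipschitz_onI)
      fix x y
      have "dist (\<Sum>b\<in>Basis. g b x *\<^sub>R b) (\<Sum>b\<in>Basis. g b y *\<^sub>R b)
          = norm (\<Sum>b\<in>Basis. (g b x - g b y) *\<^sub>R (b::'b))"
        by (simp add: dist_norm sum_subtractf scaleR_left_diff_distrib)
      also have "\<dots> \<le> (\<Sum>b\<in>(Basis::'b set). L * dist x y)"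
        using lipschitz_onD[OF g] by (intro sum_norm_le) (auto simp: dist_real_def)
      finally show "dist (\<Sum>b\<in>Basis. g b x *\<^sub>R b) (\<Sum>b\<in>Basis. g b y *\<^sub>R (b::'b))
          \<le> real DIM('b) * L * dist x y"
        by simp
    qed (use lipschitz_on_nonneg[OF f] in simp)
  qed
qed

text \<open>A perturbation of the identity: solving \<open>x + F x = y\<close> means finding a fixed
  point of the contraction that maps \<open>x\<close> to \<open>y - F x\<close>. The triangle
  inequality then shows that distances shrink at most by the factor \<open>1 - L\<close>, so the
  inverse is Lipschitz.\<close>

lemma homeomorphism_add_contraction:
  fixes F :: "'a::banach \<Rightarrow> 'a"
  assumes F: "L-lipschitz_on UNIV F" and "L < 1"
  shows "\<exists>g. homeomorphism UNIV UNIV (\<lambda>x. x + F x) g"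
proof -
  let ?h = "\<lambda>x. x + F x"
  have L: "0 \<le> L" by (rule lipschitz_on_nonneg[OF F])
  have F': "norm (F x - F y) \<le> L * norm (x - y)" for x y
    using lipschitz_onD[OF F, of x y] by (simp add: dist_norm)
  have expand: "(1 - L) * norm (x - y) \<le> norm (?h x - ?h y)" for x y
  proof -
    have "norm (x - y) = norm ((?h x - ?h y) - (F x - F y))" by (simp add: algebra_simps)
    also have "\<dots> \<le> norm (?h x - ?h y) + norm (F x - F y)" by (rule norm_triangle_ineq4)
    finally show ?thesis using F'[of x y] by (simp add: algebra_simps)
  qed
  have "\<exists>x. ?h x = y" for y
  proof -
    have "\<exists>!x. y - F x = x"
      using L \<open>L < 1\<close> F' by (intro banach_fix_type[of L]) (auto simp: dist_norm norm_minus_commute)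
    then show ?thesis by (metis diff_add_cancel)
  qed
  then obtain g where hg: "\<And>y. ?h (g y) = y" by metis
  have inj: "x = y" if "?h x = ?h y" for x y
    using expand[of x y] that \<open>L < 1\<close> by (simp add: mult_le_0_iff)
  have gh: "g (?h x) = x" for x by (rule inj) (rule hg)
  have "(inverse (1 - L))-lipschitz_on UNIV g"
  proof (rule lipschitz_onI)
    show "dist (g x) (g y) \<le> inverse (1 - L) * dist x y" for x y
      using expand[of "g x" "g y"] \<open>L < 1\<close> by (simp add: hg dist_norm field_simps)
  qed (use \<open>L < 1\<close> in simp)
  then have "continuous_on UNIV g" by (rule lipschitz_on_continuous_on)
  moreover have "continuous_on UNIV ?h"
    by (intro continuous_intros lipschitz_on_continuous_on[OF F])
  ultimately have "homeomorphism UNIV UNIV ?h g"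
    using hg gh by (auto simp: homeomorphism_def) (metis UNIV_I image_eqI)+
  then show ?thesis by blast
qed

text \<open>Scaling the displacement by \<open>t\<close> in the unit interval keeps its Lipschitz
  constant below 1, so every intermediate map is a homeomorphism.\<close>

lemma ambient_isotopic_add_contraction:
  assumes F: "L-lipschitz_on UNIV F" and "L < 1"
  shows "ambient_isotopic K ((\<lambda>x. x + F x) ` K)"
proof -
  have "\<exists>g. homeomorphism UNIV UNIV (\<lambda>x. x + t *\<^sub>R F x) g" if "t \<in> {0..1}" for t
  proof (rule homeomorphism_add_contraction)
    show "(\<bar>t\<bar> * L)-lipschitz_on UNIV (\<lambda>x. t *\<^sub>R F x)"
      by (rule lipschitz_on_cmult[OF F])
    have "\<bar>t\<bar> * L \<le> 1 * L"
      using that lipschitz_on_nonneg[OF F] by (intro mult_right_mono) auto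
    then show "\<bar>t\<bar> * L < 1" using \<open>L < 1\<close> by simp
  qed
  moreover have "continuous_map (prod_topology (top_of_set {0..1}) (top_of_set UNIV)) euclidean
      (\<lambda>z. snd z + fst z *\<^sub>R F (snd z))"
    unfolding prod_topology_subtopology_eu continuous_map_iff_continuous
    by (intro continuous_on_add continuous_on_scaleR continuous_on_fst continuous_on_snd
          continuous_on_id continuous_on_compose2[OF lipschitz_on_continuous_on[OF F] continuous_on_snd])
       auto
  ultimately have "homotopic_with_canon (\<lambda>f. \<exists>g. homeomorphism UNIV UNIV f g) UNIV UNIV
      id (\<lambda>x. x + F x)"
    unfolding homotopic_with_def
    by (intro exI[of _ "\<lambda>z. snd z + fst z *\<^sub>R F (snd z)"]) auto
  then show ?thesis unfolding ambient_isotopic_def by blast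
qed

section \<open>Composing ambient isotopies\<close>

lemma ambient_isotopic_refl: "ambient_isotopic K K"
  unfolding ambient_isotopic_def
proof (intro exI conjI)
  have "\<exists>g. homeomorphism UNIV UNIV (id :: real^3 \<Rightarrow> real^3) g"
    unfolding id_def by (rule exI) (rule homeomorphism_ident)
  then show "homotopic_with_canon (\<lambda>f. \<exists>g. homeomorphism UNIV UNIV f g) UNIV UNIV
      id (id :: real^3 \<Rightarrow> real^3)"
    by simp
qed simp

text \<open>First run the isotopy from the identity to \<open>k\<close>, then \<open>k\<close>
  composed with the isotopy from the identity to \<open>h\<close>. Composition with the
  homeomorphism \<open>k\<close> keeps all stages homeomorphisms.\<close>

lemma ambient_isotopic_trans [trans]:
  assumes "ambient_isotopic K1 K2" "ambient_isotopic K2 K3"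
  shows "ambient_isotopic K1 K3"
proof -
  let ?P = "\<lambda>f :: real^3 \<Rightarrow> real^3. \<exists>g. homeomorphism UNIV UNIV f g"
  obtain h where h: "homotopic_with_canon ?P UNIV UNIV id h" "h ` K1 = K2"
    using assms(1) unfolding ambient_isotopic_def by blast
  obtain k where k: "homotopic_with_canon ?P UNIV UNIV id k" "k ` K2 = K3"
    using assms(2) unfolding ambient_isotopic_def by blast
  have "?P k" using homotopic_with_imp_property[OF k(1)] by simp
  then have "?P (k \<circ> f)" if "?P f" for f
    using that by (metis homeomorphism_compose)
  then have "homotopic_with_canon (\<lambda>f. ?P (k \<circ> f)) UNIV UNIV id h"
    by (intro homotopic_with_mono[OF h(1)]) blast
  then have "homotopic_with_canon ?P UNIV UNIV (k \<circ> id) (k \<circ> h)"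
    by (rule homotopic_with_compose_continuous_left)
       (use \<open>?P k\<close> in \<open>auto simp: homeomorphism_def\<close>)
  then have "homotopic_with_canon ?P UNIV UNIV id (k \<circ> h)"
    using k(1) by (auto intro: homotopic_with_trans)
  moreover have "(k \<circ> h) ` K1 = K3" using h(2) k(2) by (metis image_comp)
  ultimately show ?thesis unfolding ambient_isotopic_def by blast
qed

text \<open>The hypothesis says that at every time the velocity is a function of the position with
  Lipschitz constant \<open>1 / c\<close>. During a time \<open>1 / n\<close> the displacement
  therefore has the constant \<open>1 / (n * c)\<close>, and for large \<open>n\<close> each of the
  \<open>n\<close> steps is an ambient isotopy.\<close>

lemma ambient_isotopic_linear_motion:
  fixes p q :: "'i \<Rightarrow> real^3"
  assumes "0 < c"
    and sep: "\<And>t x y. 0 \<le> t \<Longrightarrow> t \<le> 1 \<Longrightarrow> x \<in> X \<Longrightarrow> y \<in> X \<Longrightarrow>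
      c * norm ((q x - p x) - (q y - p y))
        \<le> norm ((p x + t *\<^sub>R (q x - p x)) - (p y + t *\<^sub>R (q y - p y)))"
  shows "ambient_isotopic (p ` X) (q ` X)"
proof -
  define v where "v x = q x - p x" for x
  define r where "r t x = p x + t *\<^sub>R v x" for t x
  have sep': "c * norm (v x - v y) \<le> norm (r t x - r t y)"
    if "0 \<le> t" "t \<le> 1" "x \<in> X" "y \<in> X" for t x y
    using sep[OF that] by (simp add: v_def r_def)
  \<comment> \<open>Extending a displacement to space multiplies its Lipschitz constant by 3, so a
    step of length \<open>1 / n\<close> requires \<open>3 / (n * c) < 1\<close>.\<close>
  obtain n :: nat where n: "3 / c < real n"
    using reals_Archimedean2 by blast
  have "0 < n" using n \<open>0 < c\<close> by (intro gr0I) (auto simp: field_simps)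
  have step: "ambient_isotopic (r t ` X) (r (t + 1 / n) ` X)" if t: "0 \<le> t" "t \<le> 1" for t
  proof -
    \<comment> \<open>The choice of \<open>x\<close> does not matter: by \<open>sep'\<close>, points
      that coincide at time \<open>t\<close> have equal velocities.\<close>
    define f where "f z = (1 / n) *\<^sub>R v (SOME x. x \<in> X \<and> r t x = z)" for z
    have f: "f (r t x) = (1 / n) *\<^sub>R v x" if "x \<in> X" for x
    proof -
      let ?y = "SOME y. y \<in> X \<and> r t y = r t x"
      have "?y \<in> X \<and> r t ?y = r t x" by (rule someI[of _ x]) (use that in simp)
      then have "v ?y = v x"
        using sep'[OF t _ that, of ?y] \<open>0 < c\<close> by (simp add: mult_le_0_iff)
      then show ?thesis by (simp add: f_def)
    qed
    have "(1 / (n * c))-lipschitz_on (r t ` X) f"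
    proof (rule lipschitz_onI)
      fix z w assume "z \<in> r t ` X" "w \<in> r t ` X"
      then obtain x y where xy: "x \<in> X" "y \<in> X" "z = r t x" "w = r t y" by blast
      have "dist (f z) (f w) = (1 / n) * norm (v x - v y)"
        using xy by (simp add: f dist_norm scaleR_right_diff_distrib[symmetric])
      also have "\<dots> \<le> 1 / (n * c) * dist z w"
        using sep'[OF t xy(1,2)] \<open>0 < c\<close> \<open>0 < n\<close> xy(3,4) by (simp add: dist_norm field_simps)
      finally show "dist (f z) (f w) \<le> 1 / (n * c) * dist z w" .
    qed (use \<open>0 < c\<close> in simp)
    then obtain F where F: "(real DIM(real^3) * (1 / (n * c)))-lipschitz_on UNIV F"
      and Ff: "\<And>z. z \<in> r t ` X \<Longrightarrow> F z = f z"
      by (rule lipschitz_on_extend) blast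
    have "real DIM(real^3) * (1 / (n * c)) < 1"
      using n \<open>0 < c\<close> \<open>0 < n\<close> by (simp add: field_simps)
    then have "ambient_isotopic (r t ` X) ((\<lambda>z. z + F z) ` r t ` X)"
      by (rule ambient_isotopic_add_contraction[OF F])
    also have "(\<lambda>z. z + F z) ` r t ` X = r (t + 1 / n) ` X"
      unfolding image_image by (rule image_cong) (auto simp: Ff f, auto simp: r_def algebra_simps)
    finally show ?thesis .
  qed
  have "ambient_isotopic (r 0 ` X) (r (real k / n) ` X)" if "k \<le> n" for k
    using that
  proof (induction k)
    case 0
    then show ?case by (simp add: ambient_isotopic_refl)
  next
    case (Suc k)
    then have "ambient_isotopic (r 0 ` X) (r (real k / n) ` X)" by simp
    also have "ambient_isotopic (r (real k / n) ` X) (r (real k / n + 1 / n) ` X)"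
      by (rule step) (use Suc.prems \<open>0 < n\<close> in auto)
    also have "real k / n + 1 / n = real (Suc k) / n" by (simp add: add_divide_distrib)
    finally show ?case .
  qed
  from this[of n] \<open>0 < n\<close> show ?thesis
    by (simp add: r_def[abs_def] v_def)
qed

section \<open>Polygons with linearly moving vertices\<close>

definition edges :: "'a list \<Rightarrow> ('a \<times> 'a) list" where
  "edges vs = zip vs (rotate1 vs)"

lemma closed_polygon_edges:
  "closed_polygon vs = (\<Union>(a, b)\<in>set (edges vs). closed_segment a b)"
  unfolding closed_polygon_def edges_def
  by (auto simp: set_zip nth_rotate1)

lemma edges_map: "edges (map f vs) = map (map_prod f f) (edges vs)"
  by (simp add: edges_def zip_map_map rotate1_map map_prod_def)

text \<open>A pair \<open>(p, q)\<close> stands for the point that moves from \<open>p\<close> at time \<open>0\<close> to \<open>q\<close> at time \<open>1\<close> with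
  constant velocity. Equality is admitted for the common vertex of two adjacent edges.\<close>

definition separates :: "'a::real_inner \<Rightarrow> 'a \<times> 'a \<Rightarrow> 'a \<times> 'a \<Rightarrow> bool" where
  "separates l u v \<longleftrightarrow> u = v \<or> l \<bullet> fst u < l \<bullet> fst v \<and> l \<bullet> snd u < l \<bullet> snd v"

definition position :: "real \<Rightarrow> 'a::real_vector \<times> 'a \<Rightarrow> 'a" where
  "position t u = (1 - t) *\<^sub>R fst u + t *\<^sub>R snd u"

definition displacement :: "'a::real_vector \<times> 'a \<Rightarrow> 'a" where
  "displacement u = snd u - fst u"

lemma linear_position: "linear (position t)"
  by (rule linearI) (auto simp: position_def algebra_simps)

lemma linear_displacement: "linear displacement"
  by (rule linearI) (auto simp: displacement_def algebra_simps)

lemmas position_simps =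
  linear_0[OF linear_position] linear_add[OF linear_position] linear_scale[OF linear_position]
  linear_0[OF linear_displacement] linear_add[OF linear_displacement] linear_scale[OF linear_displacement]

text \<open>The value of \<open>l\<close> on the difference of the two moving points is affine in
  \<open>t\<close>, hence at least the smaller of its values at the two end times, while the
  displacement does not depend on \<open>t\<close>. The bound uses \<open>l\<close> rather than the
  norm of the position, so that it defines a convex condition.\<close>

lemma separates_position:
  fixes u v :: "'a::real_inner \<times> 'a"
  assumes "separates l u v"
  shows "\<exists>c>0. \<forall>t\<in>{0..1}. c * norm (displacement (v - u)) \<le> l \<bullet> position t (v - u)"
proof (cases "u = v")
  case True
  then show ?thesis by (auto simp: position_simps intro: exI[of _ 1])
next
  case False
  define e where "e = min (l \<bullet> fst (v - u)) (l \<bullet> snd (v - u))"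
  have "0 < e" using assms False by (simp add: separates_def e_def inner_diff_right)
  \<comment> \<open>The summand 1 keeps the divisor positive when the displacement vanishes.\<close>
  define n where "n = norm (displacement (v - u)) + 1"
  have "0 < n" by (simp add: n_def add_nonneg_pos)
  have "e \<le> l \<bullet> position t (v - u)" if "t \<in> {0..1}" for t
  proof -
    have "e = (1 - t) * e + t * e" by (simp add: algebra_simps)
    also have "\<dots> \<le> (1 - t) * (l \<bullet> fst (v - u)) + t * (l \<bullet> snd (v - u))"
      using that by (intro add_mono mult_left_mono) (auto simp: e_def)
    finally show ?thesis by (simp add: position_def inner_add_right)
  qed
  moreover have "e / n * norm (displacement (v - u)) \<le> e"
    using \<open>0 < e\<close> \<open>0 < n\<close> by (simp add: n_def field_simps)
  ultimately show ?thesis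
    using \<open>0 < e\<close> \<open>0 < n\<close> by (intro exI[of _ "e / n"]) (auto intro: order_trans)
qed

text \<open>Convexity reduces the comparison of displacement and distance from two points on edges to the
  vertices.\<close>

lemma convex_displacement_le_position:
  "convex {z::'a::real_inner \<times> 'a. c * norm (displacement z) \<le> l \<bullet> position t z}"
  if "0 \<le> c"
proof (rule convexI)
  fix y z :: "'a \<times> 'a" and s r :: real
  assume y: "y \<in> {z. c * norm (displacement z) \<le> l \<bullet> position t z}"
    and z: "z \<in> {z. c * norm (displacement z) \<le> l \<bullet> position t z}"
    and "0 \<le> s" "0 \<le> r"
  have "c * norm (displacement (s *\<^sub>R y + r *\<^sub>R z))
      \<le> c * (s * norm (displacement y) + r * norm (displacement z))"
    using norm_triangle_ineq[of "s *\<^sub>R displacement y" "r *\<^sub>R displacement z"] \<open>0 \<le> s\<close> \<open>0 \<le> r\<close> \<open>0 \<le> c\<close>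
    by (intro mult_left_mono) (simp_all add: position_simps)
  also have "\<dots> = s * (c * norm (displacement y)) + r * (c * norm (displacement z))"
    by (simp add: algebra_simps)
  also have "\<dots> \<le> s * (l \<bullet> position t y) + r * (l \<bullet> position t z)"
    using y z \<open>0 \<le> s\<close> \<open>0 \<le> r\<close> by (intro add_mono mult_left_mono) auto
  also have "\<dots> = l \<bullet> position t (s *\<^sub>R y + r *\<^sub>R z)"
    by (simp add: position_simps inner_add_right)
  finally show "s *\<^sub>R y + r *\<^sub>R z \<in> {z. c * norm (displacement z) \<le> l \<bullet> position t z}" by simp
qed

definition edge_separates ::
  "'a::real_inner \<Rightarrow> ('a \<times> 'a) \<times> ('a \<times> 'a) \<Rightarrow> ('a \<times> 'a) \<times> ('a \<times> 'a) \<Rightarrow> bool" where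
  "edge_separates l e f \<longleftrightarrow> separates l (fst e) (fst f) \<and> separates l (fst e) (snd f) \<and>
     separates l (snd e) (fst f) \<and> separates l (snd e) (snd f)"

text \<open>Applied to one segment after the other, this carries membership in \<open>C\<close> from
  the four differences of end points to the differences of all points of two segments.\<close>

lemma convex_closed_segment_diff:
  assumes "convex C" "x \<in> closed_segment a b"
  shows "a - u \<in> C \<Longrightarrow> b - u \<in> C \<Longrightarrow> x - u \<in> C"
    and "u - a \<in> C \<Longrightarrow> u - b \<in> C \<Longrightarrow> u - x \<in> C"
proof -
  obtain s where s: "0 \<le> s" "s \<le> 1" and x: "x = (1 - s) *\<^sub>R a + s *\<^sub>R b"
    using assms(2) by (auto simp: in_segment)
  have "x - u = (1 - s) *\<^sub>R (a - u) + s *\<^sub>R (b - u)"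
    by (simp only: x) (simp add: algebra_simps)
  then show "a - u \<in> C \<Longrightarrow> b - u \<in> C \<Longrightarrow> x - u \<in> C"
    using convexD_alt[OF assms(1)] s by simp
  have "u - x = (1 - s) *\<^sub>R (u - a) + s *\<^sub>R (u - b)"
    by (simp only: x) (simp add: algebra_simps)
  then show "u - a \<in> C \<Longrightarrow> u - b \<in> C \<Longrightarrow> u - x \<in> C"
    using convexD_alt[OF assms(1)] s by simp
qed

text \<open>The least of the four constants for pairs of vertices works for all pairs of points by
  convexity. The Cauchy-Schwarz inequality then replaces the value of \<open>l\<close> by the norm,
  with \<open>norm l + 1\<close> as a divisor that is positive even for
  \<open>l = 0\<close>.\<close>

lemma edge_separates_distance:
  fixes e f :: "('a::real_inner \<times> 'a) \<times> ('a \<times> 'a)"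
  assumes "edge_separates l e f"
  shows "\<exists>c>0. \<forall>t\<in>{0..1}. \<forall>x\<in>closed_segment (fst e) (snd e). \<forall>y\<in>closed_segment (fst f) (snd f).
    c * norm (displacement (y - x)) \<le> norm (position t (y - x))"
proof -
  have "\<exists>c>0. \<forall>t\<in>{0..1}. c * norm (displacement (v - u)) \<le> l \<bullet> position t (v - u)"
    if "u \<in> {fst e, snd e}" "v \<in> {fst f, snd f}" for u v
    using that assms by (intro separates_position) (auto simp: edge_separates_def)
  then obtain k where k: "\<And>u v. u \<in> {fst e, snd e} \<Longrightarrow> v \<in> {fst f, snd f} \<Longrightarrow> 0 < k u v \<and>
      (\<forall>t\<in>{0..1}. k u v * norm (displacement (v - u)) \<le> l \<bullet> position t (v - u))"
    by metis
  define c where "c = Min ((\<lambda>(u, v). k u v) ` ({fst e, snd e} \<times> {fst f, snd f}))"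
  have "0 < c" using k unfolding c_def by (subst Min_gr_iff) auto
  have "c \<le> k u v" if "u \<in> {fst e, snd e}" "v \<in> {fst f, snd f}" for u v
    unfolding c_def using that by (intro Min_le) auto
  then have c: "c * norm (displacement (v - u)) \<le> l \<bullet> position t (v - u)"
    if "u \<in> {fst e, snd e}" "v \<in> {fst f, snd f}" "t \<in> {0..1}" for u v t
    using k[OF that(1,2)] that by (meson mult_right_mono norm_ge_zero order_trans)
  have "c * norm (displacement (y - x)) \<le> (norm l + 1) * norm (position t (y - x))"
    if x: "x \<in> closed_segment (fst e) (snd e)" and y: "y \<in> closed_segment (fst f) (snd f)"
      and t: "t \<in> {0..1}" for x y t
  proof -
    define C where "C = {z. c * norm (displacement z) \<le> l \<bullet> position t z}"
    have "convex C" unfolding C_def by (rule convex_displacement_le_position) (use \<open>0 < c\<close> in simp)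
    have "v - x \<in> C" if "v \<in> {fst f, snd f}" for v
      using c[OF _ that t] by (intro convex_closed_segment_diff(2)[OF \<open>convex C\<close> x]) (simp_all add: C_def)
    then have "y - x \<in> C"
      by (intro convex_closed_segment_diff(1)[OF \<open>convex C\<close> y]) simp_all
    then have "c * norm (displacement (y - x)) \<le> l \<bullet> position t (y - x)" by (simp add: C_def)
    also have "\<dots> \<le> norm l * norm (position t (y - x))" by (rule norm_cauchy_schwarz)
    also have "\<dots> \<le> (norm l + 1) * norm (position t (y - x))" by (simp add: mult_right_mono)
    finally show ?thesis .
  qed
  moreover have "0 < norm l + 1" by (simp add: add_nonneg_pos)
  ultimately show ?thesis
    using \<open>0 < c\<close>
    by (intro exI[of _ "c / (norm l + 1)"]) (auto simp: field_simps)
qed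

text \<open>Differences of two points of one edge are multiples of \<open>b - a\<close>, and both
  sides scale by the same factor, so the bound for the end points suffices.\<close>

lemma edge_distance:
  fixes a b :: "'a::real_inner \<times> 'a"
  assumes "separates l a b" "a \<noteq> b"
  shows "\<exists>c>0. \<forall>t\<in>{0..1}. \<forall>x\<in>closed_segment a b. \<forall>y\<in>closed_segment a b.
    c * norm (displacement (y - x)) \<le> norm (position t (y - x))"
proof -
  obtain c where "0 < c"
    and c: "\<And>t. t \<in> {0..1} \<Longrightarrow> c * norm (displacement (b - a)) \<le> l \<bullet> position t (b - a)"
    using separates_position[OF assms(1)] by blast
  have "c * norm (displacement (y - x)) \<le> (norm l + 1) * norm (position t (y - x))"
    if xy: "x \<in> closed_segment a b" "y \<in> closed_segment a b" and t: "t \<in> {0..1}" for x y t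
  proof -
    obtain r s where rs: "x = (1 - r) *\<^sub>R a + r *\<^sub>R b" "y = (1 - s) *\<^sub>R a + s *\<^sub>R b"
      using xy by (auto simp: in_segment)
    then have yx: "y - x = (s - r) *\<^sub>R (b - a)"
      by (simp only: rs) (simp add: algebra_simps)
    have "c * norm (displacement (b - a)) \<le> norm l * norm (position t (b - a))"
      using c[OF t] norm_cauchy_schwarz[of l "position t (b - a)"] by linarith
    also have "\<dots> \<le> (norm l + 1) * norm (position t (b - a))" by (simp add: mult_right_mono)
    finally have "\<bar>s - r\<bar> * (c * norm (displacement (b - a)))
        \<le> \<bar>s - r\<bar> * ((norm l + 1) * norm (position t (b - a)))"
      by (rule mult_left_mono) simp
    then show ?thesis
      unfolding yx position_simps norm_scaleR by (simp only: mult.left_commute)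
  qed
  moreover have "0 < norm l + 1" by (simp add: add_nonneg_pos)
  ultimately show ?thesis
    using \<open>0 < c\<close>
    by (intro exI[of _ "c / (norm l + 1)"]) (auto simp: field_simps)
qed

text \<open>A motion is treated as one closed polygon in the product of two copies of space. Its
  projections by \<open>fst\<close> and \<open>snd\<close> are the polygons at times 0 and 1, and
  each of its points is a point moving linearly. There are finitely many pairs of edges, so the
  least of their constants serves for the whole polygon.\<close>

lemma closed_polygon_motion:
  fixes us :: "((real^3) \<times> (real^3)) list"
  assumes nondeg: "\<And>a b. (a, b) \<in> set (edges us) \<Longrightarrow> \<exists>l. separates l a b \<and> a \<noteq> b"
    and sep: "sorted_wrt (\<lambda>e f. \<exists>l. edge_separates l e f \<or> edge_separates l f e) (edges us)"
  shows "ambient_isotopic (closed_polygon (map fst us)) (closed_polygon (map snd us))"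
proof -
  define E where "E = set (edges us)"
  define S where "S = (\<lambda>e. closed_segment (fst e) (snd e :: (real^3) \<times> (real^3)))"
  define Q where "Q c e f \<longleftrightarrow> 0 < c \<and> (\<forall>t\<in>{0..1}. \<forall>x\<in>S e. \<forall>y\<in>S f.
    c * norm (displacement (y - x)) \<le> norm (position t (y - x)))" for c e f
  \<comment> \<open>Each pair of distinct positions is listed only once in \<open>sep\<close>, with
    the functional increasing in either direction.\<close>
  have Q_commute: "Q c e f" if "Q c f e" for c e f
  proof -
    have "c * norm (displacement (y - x)) \<le> norm (position t (y - x))"
      if "t \<in> {0..1}" "x \<in> S e" "y \<in> S f" for t x y
    proof -
      have "c * norm (displacement (x - y)) \<le> norm (position t (x - y))"
        using \<open>Q c f e\<close> that by (simp add: Q_def)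
      moreover have "displacement (y - x) = - displacement (x - y)"
        "position t (y - x) = - position t (x - y)"
        by (simp_all add: position_def displacement_def algebra_simps)
      ultimately show ?thesis by (simp only: norm_minus_cancel)
    qed
    then show ?thesis using that by (simp add: Q_def)
  qed
  have "\<exists>c. Q c e f" if "e \<in> E" "f \<in> E" for e f
  proof -
    obtain i j where ij: "i < length (edges us)" "j < length (edges us)"
      "e = edges us ! i" "f = edges us ! j"
      using \<open>e \<in> E\<close> \<open>f \<in> E\<close> by (auto simp: E_def in_set_conv_nth)
    then consider "e = f" | l where "edge_separates l e f" | l where "edge_separates l f e"
      using sep[unfolded sorted_wrt_iff_nth_less] by (metis linorder_neqE_nat)
    then show ?thesis
    proof cases
      case 1
      then show ?thesis
        using nondeg[of "fst e" "snd e"] edge_distance \<open>e \<in> E\<close>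
        unfolding Q_def S_def E_def by (metis prod.collapse)
    next
      case 2
      then show ?thesis using edge_separates_distance unfolding Q_def S_def by blast
    next
      case 3
      then have "\<exists>c. Q c f e" using edge_separates_distance unfolding Q_def S_def by blast
      then show ?thesis using Q_commute by blast
    qed
  qed
  then obtain k where k: "\<And>e f. e \<in> E \<Longrightarrow> f \<in> E \<Longrightarrow> Q (k e f) e f" by metis
  \<comment> \<open>The element 1 keeps the minimum defined for an empty polygon.\<close>
  define c where "c = Min (insert 1 ((\<lambda>(e, f). k e f) ` (E \<times> E)))"
  have "finite E" by (simp add: E_def)
  then have "0 < c" using k by (auto simp: c_def Q_def)
  have c: "c * norm (displacement (y - x)) \<le> norm (position t (y - x))"
    if "t \<in> {0..1}" "x \<in> S e" "y \<in> S f" "e \<in> E" "f \<in> E" for t x y e f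
  proof -
    have "c \<le> k e f" unfolding c_def using \<open>finite E\<close> that by (intro Min_le) auto
    then have "c * norm (displacement (y - x)) \<le> k e f * norm (displacement (y - x))"
      by (rule mult_right_mono) simp
    also have "\<dots> \<le> norm (position t (y - x))" using k[of e f] that by (simp add: Q_def)
    finally show ?thesis .
  qed
  have "ambient_isotopic (fst ` (\<Union>e\<in>E. S e)) (snd ` (\<Union>e\<in>E. S e))"
  proof (rule ambient_isotopic_linear_motion[OF \<open>0 < c\<close>])
    fix t :: real and x y assume "0 \<le> t" "t \<le> 1" "x \<in> (\<Union>e\<in>E. S e)" "y \<in> (\<Union>e\<in>E. S e)"
    then obtain e f where "x \<in> S e" "e \<in> E" "y \<in> S f" "f \<in> E" by blast
    then have "c * norm (displacement (x - y)) \<le> norm (position t (x - y))"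
      using c[of t y f x e] \<open>0 \<le> t\<close> \<open>t \<le> 1\<close> by simp
    then show "c * norm (snd x - fst x - (snd y - fst y))
        \<le> norm (fst x + t *\<^sub>R (snd x - fst x) - (fst y + t *\<^sub>R (snd y - fst y)))"
      by (simp add: displacement_def position_def algebra_simps)
  qed
  moreover have "fst ` (\<Union>e\<in>E. S e) = closed_polygon (map fst us)"
    by (auto simp: closed_polygon_edges edges_map E_def S_def image_UN
          closed_segment_linear_image[OF linear_fst] case_prod_unfold)
  moreover have "snd ` (\<Union>e\<in>E. S e) = closed_polygon (map snd us)"
    by (auto simp: closed_polygon_edges edges_map E_def S_def image_UN
          closed_segment_linear_image[OF linear_snd] case_prod_unfold)
  ultimately show ?thesis by simp
qed

section \<open>Simple closed polygons\<close>

fun polyline :: "'a::real_vector list \<Rightarrow> 'a set" where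
  "polyline (a # b # xs) = closed_segment a b \<union> polyline (b # xs)"
| "polyline xs = {}"

lemma polyline_edges: "polyline vs = (\<Union>(a, b)\<in>set (zip vs (tl vs)). closed_segment a b)"
  by (induction vs rule: polyline.induct) auto

lemma edges_Cons: "edges (a # xs) = zip (a # xs) xs @ [(last (a # xs), a)]"
proof -
  have "zip (a # xs) (xs @ [c]) = zip (a # xs) xs @ [(last (a # xs), c)]" for c
    by (induction xs arbitrary: a) auto
  then show ?thesis by (simp add: edges_def)
qed

lemma polyline_append: "polyline (xs @ a # ys) = polyline (xs @ [a]) \<union> polyline (a # ys)"
proof (induction xs)
  case (Cons b xs)
  then show ?case by (cases xs) auto
qed simp

lemma polyline_rev: "polyline (rev xs) = polyline xs"
proof (induction xs rule: polyline.induct)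
  case (1 a b xs)
  then show ?case
    by (simp add: polyline_append[of "rev xs" b "[a]"] closed_segment_commute Un_commute)
qed auto

lemma closed_polygon_polyline: "closed_polygon (a # xs) = polyline (a # xs @ [a])"
  using zip_append1[of "a # xs" "[a]" "xs @ [a]"]
  by (simp add: closed_polygon_edges edges_def polyline_edges)

lemma closed_polygon_rotate: "closed_polygon (rotate k vs) = closed_polygon vs"
proof (induction k)
  case (Suc k)
  have "closed_polygon (rotate1 vs) = closed_polygon vs" for vs
  proof (cases vs)
    case (Cons a xs)
    show ?thesis
    proof (cases xs)
      case xs: (Cons b ys)
      have "polyline (b # ys @ [a, b]) = polyline (b # ys @ [a]) \<union> closed_segment a b"
        using polyline_append[of "b # ys" a "[b]"] by simp
      then show ?thesis using Cons xs by (simp add: closed_polygon_polyline Un_commute)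
    qed (use Cons in simp)
  qed simp
  with Suc show ?case by simp
qed simp

lemma closed_polygon_rev: "closed_polygon (rev vs) = closed_polygon vs"
proof (cases vs)
  case (Cons a xs)
  have "closed_polygon (rev vs) = closed_polygon (a # rev xs)"
    using closed_polygon_rotate[of 1 "a # rev xs"] Cons by simp
  also have "\<dots> = polyline (rev (a # xs @ [a]))" by (simp add: closed_polygon_polyline)
  also have "\<dots> = closed_polygon vs" by (simp only: polyline_rev closed_polygon_polyline Cons)
  finally show ?thesis .
qed simp

text \<open>The first edge is joined to the arc formed by the others. A common point must be an end
  point of both edges involved, and \<open>a\<close> does not occur among the later vertices, so
  only \<open>b\<close> remains.\<close>

lemma arc_polyline:
  fixes vs :: "'a::euclidean_space list"
  assumes "distinct vs" "2 \<le> length vs"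
    and "sorted_wrt (\<lambda>(a, a') (b, b'). closed_segment a a' \<inter> closed_segment b b' \<subseteq> {a, a'} \<inter> {b, b'})
      (zip vs (tl vs))"
  shows "\<exists>g. arc g \<and> pathstart g = hd vs \<and> pathfinish g = last vs \<and> path_image g = polyline vs"
  using assms
proof (induction vs rule: polyline.induct)
  case (1 a b xs)
  show ?case
  proof (cases xs)
    case Nil
    then show ?thesis using 1 by (intro exI[of _ "linepath a b"]) (auto intro: arc_linepath)
  next
    case (Cons c ys)
    then obtain g where g: "arc g" "pathstart g = b" "pathfinish g = last (b # xs)"
      "path_image g = polyline (b # xs)"
      using 1 by auto
    have "closed_segment a b \<inter> polyline (b # xs) \<subseteq> {b}"
    proof
      fix x assume x: "x \<in> closed_segment a b \<inter> polyline (b # xs)"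
      then obtain u v where uv: "(u, v) \<in> set (zip (b # xs) xs)" "x \<in> closed_segment u v"
        by (auto simp: polyline_edges)
      then have "x \<in> {a, b} \<inter> {u, v}" using 1(4) x by fastforce
      moreover have "u \<noteq> a" "v \<noteq> a"
        using set_zip_leftD[OF uv(1)] set_zip_rightD[OF uv(1)] 1(2) by auto
      ultimately show "x \<in> {b}" by auto
    qed
    then have "arc (linepath a b +++ g)"
      using g 1(2) by (intro arc_join) (auto intro: arc_linepath)
    then show ?thesis
      using g by (intro exI[of _ "linepath a b +++ g"]) (auto simp: path_image_join Cons)
  qed
qed auto

text \<open>All edges but the closing one form an arc, which the closing edge meets only in its two
  end points. The result is a simple closed path, whose image is homeomorphic to a circle.\<close>

lemma knot_closed_polygon:
  assumes "distinct vs" "2 \<le> length vs"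
    and disj: "sorted_wrt (\<lambda>(a, a') (b, b'). closed_segment a a' \<inter> closed_segment b b' \<subseteq> {a, a'} \<inter> {b, b'})
      (edges vs)"
  shows "knot (closed_polygon vs)"
proof -
  obtain a xs where vs: "vs = a # xs" "xs \<noteq> []"
    using \<open>2 \<le> length vs\<close> by (cases vs) force+
  obtain g where g: "arc g" "pathstart g = a" "pathfinish g = last vs" "path_image g = polyline vs"
    using arc_polyline[OF assms(1,2)] disj vs by (auto simp: edges_Cons sorted_wrt_append)
  have last: "last vs \<noteq> a" using assms(1) vs by auto
  have "polyline vs \<inter> closed_segment (last vs) a \<subseteq> {a, last vs}"
    using disj vs by (fastforce simp: edges_Cons sorted_wrt_append polyline_edges)
  then have "simple_path (g +++ linepath (last vs) a)"
    using g last by (intro simple_path_join_loop) (auto intro: arc_linepath)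
  then have "path_image (g +++ linepath (last vs) a) homeomorphic (sphere 0 1 :: complex set)"
    by (intro homeomorphic_simple_path_image_circle) (use g in auto)
  moreover have "path_image (g +++ linepath (last vs) a) = closed_polygon vs"
    using g vs by (simp add: path_image_join closed_polygon_edges edges_Cons polyline_edges Un_commute)
  ultimately show ?thesis by (simp add: knot_def)
qed

text \<open>At a common point, zero is the combination of the four differences
  \<open>l \<bullet> v - l \<bullet> u\<close> of vertices with the products of the barycentric
  coordinates as weights. All terms are nonnegative, hence zero, so every pair of vertices with
  positive weight coincides.\<close>

lemma edge_separates_Int:
  fixes a a' b b' :: "'a::real_inner"
  assumes sep: "edge_separates l ((a, a), (a', a')) ((b, b), (b', b'))" and "a \<noteq> a'" "b \<noteq> b'"
  shows "closed_segment a a' \<inter> closed_segment b b' \<subseteq> {a, a'} \<inter> {b, b'}"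
proof
  fix x assume "x \<in> closed_segment a a' \<inter> closed_segment b b'"
  then obtain s r where s: "0 \<le> s" "s \<le> 1" "x = (1 - s) *\<^sub>R a + s *\<^sub>R a'"
    and r: "0 \<le> r" "r \<le> 1" "x = (1 - r) *\<^sub>R b + r *\<^sub>R b'"
    by (auto simp: in_segment)
  have le: "0 \<le> w * (l \<bullet> v - l \<bullet> u)" "w * (l \<bullet> v - l \<bullet> u) = 0 \<Longrightarrow> w = 0 \<or> u = v"
    if "separates l (u, u) (v, v)" "0 \<le> w" for u v w
    using that by (auto simp: separates_def)
  let ?d = "\<lambda>w u v. w * (l \<bullet> v - l \<bullet> u)"
  have "?d ((1 - s) * (1 - r)) a b + ?d ((1 - s) * r) a b' + ?d (s * (1 - r)) a' b + ?d (s * r) a' b'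
      = l \<bullet> ((1 - r) *\<^sub>R b + r *\<^sub>R b') - l \<bullet> ((1 - s) *\<^sub>R a + s *\<^sub>R a')"
    by (simp add: inner_add_right algebra_simps)
  also have "\<dots> = 0" using s r by simp
  finally have sum: "?d ((1 - s) * (1 - r)) a b + ?d ((1 - s) * r) a b' + ?d (s * (1 - r)) a' b
      + ?d (s * r) a' b' = 0" .
  have seps: "separates l (a, a) (b, b)" "separates l (a, a) (b', b')"
    "separates l (a', a') (b, b)" "separates l (a', a') (b', b')"
    using sep by (auto simp: edge_separates_def)
  have weights: "0 \<le> (1 - s) * (1 - r)" "0 \<le> (1 - s) * r" "0 \<le> s * (1 - r)" "0 \<le> s * r"
    using s r by auto
  have "?d ((1 - s) * (1 - r)) a b = 0" "?d ((1 - s) * r) a b' = 0" "?d (s * (1 - r)) a' b = 0"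
    "?d (s * r) a' b' = 0"
    using sum le(1)[OF seps(1) weights(1)] le(1)[OF seps(2) weights(2)]
      le(1)[OF seps(3) weights(3)] le(1)[OF seps(4) weights(4)] by linarith+
  then have "(1 - s) * (1 - r) = 0 \<or> a = b" "(1 - s) * r = 0 \<or> a = b'"
    "s * (1 - r) = 0 \<or> a' = b" "s * r = 0 \<or> a' = b'"
    using le(2)[OF seps(1) weights(1)] le(2)[OF seps(2) weights(2)]
      le(2)[OF seps(3) weights(3)] le(2)[OF seps(4) weights(4)] by blast+
  \<comment> \<open>If one of the parameters were strictly between 0 and 1, both end points of its
    edge would equal the same vertex of the other edge, although they are distinct.\<close>
  then have "s = 0 \<and> r = 0 \<and> a = b \<or> s = 0 \<and> r = 1 \<and> a = b' \<or>
      s = 1 \<and> r = 0 \<and> a' = b \<or> s = 1 \<and> r = 1 \<and> a' = b'"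
    using assms(2,3) by (cases "s = 0"; cases "s = 1"; cases "r = 0"; cases "r = 1") auto
  then show "x \<in> {a, a'} \<inter> {b, b'}" using s(3) r(3) by auto
qed

section \<open>Integer certificates\<close>

type_synonym int3 = "int \<times> int \<times> int"

text \<open>The vertices of the tie curves involve quarters and thirds, hence the denominator 12.\<close>

definition pt :: "int3 \<Rightarrow> real^3" where
  "pt = (\<lambda>(x, y, z). vector [of_int x / 12, of_int y / 12, of_int z / 12])"

fun dot3 :: "int3 \<Rightarrow> int3 \<Rightarrow> int" where
  "dot3 (a, b, c) (x, y, z) = a * x + b * y + c * z"

lemma pt_eq_iff: "pt u = pt v \<longleftrightarrow> u = v"
  by (cases u; cases v) (auto simp: pt_def vec_eq_iff forall_3)

text \<open>Only comparisons of such values matter, so the positive factor \<open>1 / 144\<close>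
  drops out and the certificates are purely integral.\<close>

lemma inner_pt: "pt l \<bullet> pt v = of_int (dot3 l v) / 144"
  by (cases l; cases v) (simp add: pt_def inner_vec_def sum_3 add_divide_distrib)

definition below :: "int3 \<Rightarrow> int3 \<times> int3 \<Rightarrow> int3 \<times> int3 \<Rightarrow> bool" where
  "below l u v \<longleftrightarrow> dot3 l (fst u) < dot3 l (fst v) \<and> dot3 l (snd u) < dot3 l (snd v)"

definition edge_below ::
  "int3 \<Rightarrow> (int3 \<times> int3) \<times> (int3 \<times> int3) \<Rightarrow> (int3 \<times> int3) \<times> (int3 \<times> int3) \<Rightarrow> bool" where
  "edge_below l = (\<lambda>(a, a') (b, b'). (a = b \<or> below l a b) \<and> (a = b' \<or> below l a b') \<and>
     (a' = b \<or> below l a' b) \<and> (a' = b' \<or> below l a' b'))"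

text \<open>\<open>L\<close> lists the normal vectors of the separating functionals; a few of them serve all pairs of edges.\<close>

definition certified :: "int3 list \<Rightarrow> (int3 \<times> int3) list \<Rightarrow> bool" where
  "certified L us \<longleftrightarrow>
    list_all (\<lambda>(a, b). list_ex (\<lambda>l. below l a b \<or> below l b a) L) (edges us) \<and>
    sorted_wrt (\<lambda>e f. list_ex (\<lambda>l. edge_below l e f \<or> edge_below l f e) L) (edges us)"

abbreviation pts :: "int3 \<times> int3 \<Rightarrow> (real^3) \<times> (real^3)" where
  "pts \<equiv> map_prod pt pt"

lemma separates_pts: "separates (pt l) (pts u) (pts v) \<longleftrightarrow> u = v \<or> below l u v"
  by (cases u; cases v) (auto simp: separates_def below_def inner_pt pt_eq_iff)

lemma edge_separates_pts:
  "edge_separates (pt l) (map_prod pts pts e) (map_prod pts pts f) \<longleftrightarrow> edge_below l e f"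
  by (simp add: edge_separates_def separates_pts edge_below_def case_prod_unfold)

lemma below_irrefl: "\<not> below l u u"
  by (simp add: below_def)

lemma certified_sorted_wrt:
  assumes "certified L us"
  shows "sorted_wrt (\<lambda>e f. \<exists>l. edge_separates l e f \<or> edge_separates l f e) (edges (map pts us))"
  using assms unfolding certified_def edges_map sorted_wrt_map
  by (elim conjE sorted_wrt_mono_rel[rotated]) (auto simp: list_ex_iff simp flip: edge_separates_pts)

lemma certified_edge:
  assumes "certified L us" "(a, b) \<in> set (edges us)"
  shows "a \<noteq> b"
  using assms by (auto simp: certified_def list_all_iff list_ex_iff below_irrefl)

lemma certified_motion:
  assumes "length ps = length qs" and cert: "certified L (zip ps qs)"
  shows "ambient_isotopic (closed_polygon (map pt ps)) (closed_polygon (map pt qs))"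
proof -
  have "ambient_isotopic (closed_polygon (map fst (map pts (zip ps qs))))
      (closed_polygon (map snd (map pts (zip ps qs))))"
  proof (rule closed_polygon_motion)
    fix a b assume "(a, b) \<in> set (edges (map pts (zip ps qs)))"
    then obtain u v where uv: "(u, v) \<in> set (edges (zip ps qs))" "a = pts u" "b = pts v"
      by (auto simp: edges_map)
    then obtain l where "below l u v \<or> below l v u"
      using cert by (fastforce simp: certified_def list_all_iff list_ex_iff)
    then have "separates (pt l) a b \<or> separates (pt l) b a"
      using uv by (auto simp: separates_pts)
    moreover have "a \<noteq> b"
      using uv certified_edge[OF cert uv(1)] by (cases u; cases v) (simp add: pt_eq_iff)
    \<comment> \<open>Certificates admit either order of the end points; negating the functional
      reverses it.\<close>
    ultimately have "separates (pt l) a b \<or> separates (- pt l) a b"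
      by (auto simp: separates_def)
    with \<open>a \<noteq> b\<close> show "\<exists>l. separates l a b \<and> a \<noteq> b" by blast
  qed (rule certified_sorted_wrt[OF cert])
  moreover have "map fst (map pts (zip ps qs)) = map pt (map fst (zip ps qs))"
    "map snd (map pts (zip ps qs)) = map pt (map snd (zip ps qs))"
    by (simp_all add: comp_def)
  ultimately show ?thesis using assms(1) by (simp only: map_fst_zip map_snd_zip)
qed

text \<open>A motion in which all vertices rest: its certificate states that distinct edges meet at
  most in common vertices.\<close>

lemma certified_knot:
  assumes "distinct ps" "2 \<le> length ps" and cert: "certified L (zip ps ps)"
  shows "knot (closed_polygon (map pt ps))"
proof (rule knot_closed_polygon)
  show "distinct (map pt ps)"
    using assms(1) by (simp add: distinct_map inj_on_def pt_eq_iff)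
  have zip: "zip ps ps = map (\<lambda>p. (p, p)) ps" by (induction ps) auto
  define dup where "dup = map_prod (\<lambda>a::real^3. (a, a)) (\<lambda>a::real^3. (a, a))"
  have edges: "edges (map pts (zip ps ps)) = map dup (edges (map pt ps))"
    unfolding dup_def edges_map[symmetric] by (simp add: zip comp_def)
  have nondeg: "a \<noteq> b" if "(a, b) \<in> set (edges (map pt ps))" for a b
    using that certified_edge[OF cert] by (fastforce simp: edges_map zip pt_eq_iff)
  have "sorted_wrt (\<lambda>e f. \<exists>l. edge_separates l (dup e) (dup f) \<or> edge_separates l (dup f) (dup e))
      (edges (map pt ps))"
    using certified_sorted_wrt[OF cert] by (simp only: edges sorted_wrt_map)
  then show "sorted_wrt (\<lambda>(a, a') (b, b').
      closed_segment a a' \<inter> closed_segment b b' \<subseteq> {a, a'} \<inter> {b, b'}) (edges (map pt ps))"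
  proof (rule sorted_wrt_mono_rel[rotated])
    fix e f assume ef: "e \<in> set (edges (map pt ps))" "f \<in> set (edges (map pt ps))"
      and sep: "\<exists>l. edge_separates l (dup e) (dup f) \<or> edge_separates l (dup f) (dup e)"
    obtain a a' b b' where e: "e = (a, a')" and f: "f = (b, b')" by (cases e, cases f)
    have "a \<noteq> a'" "b \<noteq> b'" using nondeg ef e f by auto
    then have "closed_segment a a' \<inter> closed_segment b b' \<subseteq> {a, a'} \<inter> {b, b'}"
      using sep edge_separates_Int[of _ a a' b b'] edge_separates_Int[of _ b b' a a']
      unfolding e f dup_def by auto
    then show "(case e of (a, a') \<Rightarrow> \<lambda>(b, b').
        closed_segment a a' \<inter> closed_segment b b' \<subseteq> {a, a'} \<inter> {b, b'}) f"
      by (simp add: e f)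
  qed
qed (use assms(2) in simp)

section \<open>Removing vertices that only subdivide an edge\<close>

text \<open>The quotient \<open>d / n\<close> is the parameter of the orthogonal projection of
  \<open>b\<close> to the line through \<open>a\<close> and \<open>c\<close>. The three equations,
  cleared of denominators, say that \<open>b\<close> is its own projection.\<close>

fun lies_between :: "int3 \<Rightarrow> int3 \<Rightarrow> int3 \<Rightarrow> bool" where
  "lies_between (a1, a2, a3) (b1, b2, b3) (c1, c2, c3) \<longleftrightarrow>
    (let u = (b1 - a1, b2 - a2, b3 - a3); w = (c1 - a1, c2 - a2, c3 - a3); d = dot3 u w; n = dot3 w w
     in 0 < n \<and> 0 \<le> d \<and> d \<le> n \<and>
        n * (b1 - a1) = d * (c1 - a1) \<and> n * (b2 - a2) = d * (c2 - a2) \<and> n * (b3 - a3) = d * (c3 - a3))"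

lemma lies_between_closed_segment:
  assumes "lies_between a b c"
  shows "pt b \<in> closed_segment (pt a) (pt c)"
proof -
  obtain a1 a2 a3 b1 b2 b3 c1 c2 c3 where
    abc: "a = (a1, a2, a3)" "b = (b1, b2, b3)" "c = (c1, c2, c3)"
    by (cases a, cases b, cases c)
  obtain d n where "0 < n" "0 \<le> d" "d \<le> n" and eq:
    "n * (b1 - a1) = d * (c1 - a1)" "n * (b2 - a2) = d * (c2 - a2)" "n * (b3 - a3) = d * (c3 - a3)"
    using assms unfolding abc lies_between.simps Let_def by blast
  define s where "s = real_of_int d / of_int n"
  have comp: "of_int y = (1 - s) * of_int x + s * of_int z" if "n * (y - x) = d * (z - x)" for x y z
  proof -
    have "real_of_int n * (of_int y - of_int x) = of_int d * (of_int z - of_int x)"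
      using arg_cong[OF that, of real_of_int] by simp
    then show ?thesis using \<open>0 < n\<close> by (simp add: s_def field_simps)
  qed
  have "pt b = (1 - s) *\<^sub>R pt a + s *\<^sub>R pt c"
    using comp[OF eq(1)] comp[OF eq(2)] comp[OF eq(3)]
    by (simp add: abc pt_def vec_eq_iff forall_3 add_divide_distrib)
  moreover have "0 \<le> s" "s \<le> 1" using \<open>0 < n\<close> \<open>0 \<le> d\<close> \<open>d \<le> n\<close> by (simp_all add: s_def)
  ultimately show ?thesis by (auto simp: in_segment)
qed

fun merge_edges :: "int3 list \<Rightarrow> int3 list" where
  "merge_edges (a # b # c # xs) =
    (if lies_between a b c then merge_edges (a # c # xs) else a # merge_edges (b # c # xs))"
| "merge_edges xs = xs"

lemma polyline_merge_edges: "polyline (map pt (merge_edges xs)) = polyline (map pt xs)"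
proof (induction xs rule: merge_edges.induct)
  case (1 a b c xs)
  show ?case
  proof (cases "lies_between a b c")
    case True
    then show ?thesis
      using 1(1) Un_closed_segment[OF lies_between_closed_segment[OF True]] by auto
  next
    case False
    \<comment> \<open>Merging never removes the first vertex, so the edge from \<open>a\<close> to
      \<open>b\<close> survives.\<close>
    have "\<exists>ys. merge_edges (b # zs) = b # ys" for b zs
      by (induction "b # zs" arbitrary: zs rule: merge_edges.induct) auto
    then obtain ys where "merge_edges (b # c # xs) = b # ys" by blast
    with 1(2)[OF False] False show ?thesis by simp
  qed
qed auto

text \<open>The closed polygon is cut open at \<open>a\<close>, and the two ends of the list are
  never removed. To recover the coarse polygon, the list must thus start at a genuine
  corner.\<close>

lemma closed_polygon_merge_edges:
  assumes "merge_edges (a # xs @ [a]) = b # ys @ [b]"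
  shows "closed_polygon (map pt (a # xs)) = closed_polygon (map pt (b # ys))"
  using polyline_merge_edges[of "a # xs @ [a]"] assms by (simp add: closed_polygon_polyline)

text \<open>For the crossings of explicit words, where indices are numerals rather than
  successors.\<close>

lemma region_before_eq: "region_before w k = (if k = 0 then Right else fst (w ! (k - 1)))"
  by (cases k) auto

section \<open>The two chains of motions\<close>

text \<open>Stage 0 is the trefoil with its edges subdivided, the last stage is the tie curve. The stages in
  between are rounded snapshots of a numerical descent of both ends along a repulsive knot energy.\<close>

definition left_stage0 :: "int3 list" where
  "left_stage0 =
    [(0, 4, -4), (0, 32, 4), (0, 60, 12), (20, 40, 4), (40, 20, -4), (60, 0, -12), (32, 0, -4),
     (4, 0, 4), (-24, 0, 12), (-24, 30, 0), (-24, 60, -12), (-3, 39, -6), (18, 18, 0),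
     (39, -3, 6), (60, -24, 12), (30, -24, 0), (0, -24, -12)]"

definition left_stage1 :: "int3 list" where
  "left_stage1 =
    [(-1, -5, -6), (-9, 3, 2), (-6, 13, 4), (4, 14, 2), (8, 8, -1), (6, 1, 0), (3, -4, 3),
     (0, -9, 4), (-4, -12, 2), (-10, -12, -2), (-14, -6, -8), (-10, 4, -10), (-2, 7, -5),
     (2, 5, 5), (9, 2, 9), (13, -4, 4), (9, -7, -5)]"

definition left_stage2 :: "int3 list" where
  "left_stage2 =
    [(1, -4, -1), (-2, 1, -4), (-9, 15, 4), (11, 18, -2), (9, 3, -1), (-2, -1, 3),
     (-5, -6, -2), (-1, -9, -6), (5, -12, -3), (-1, -14, 6), (-14, -6, 2), (-11, 7, -9),
     (0, 11, -6), (6, 8, 7), (5, -1, 8), (3, -5, 4), (1, -5, 1)]"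

text \<open>The 17 vertices are five of the passive strand up to \<open>a\<close>, two for each of
  the four moves, and four of the tuck. The earlier stages have equally many vertices, in
  corresponding order.\<close>

definition left_stage3 :: "int3 list" where
  "left_stage3 =
    [(0, -48, 0), (0, 0, 0), (-60, 60, 0), (60, 60, 0), (6, 6, 0), (0, 0, 12), (-3, 0, 0),
     (0, -12, -12), (9, 0, 0), (0, -24, 12), (-15, 0, 0), (-36, 36, -12), (0, 42, 0),
     (48, 48, 12), (6, -8, 16), (3, -12, 0), (3, -16, -4)]"

lemma certified_left0:
  "certified
    [(3, 0, 4), (-1, -3, 1), (1, 0, -1), (1, 1, -1), (1, -1, 1), (1, -2, -2), (1, 1, 0),
     (0, 3, -1)]
    (zip left_stage0 left_stage1)"
  by code_simp

lemma certified_left1: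
  "certified
    [(1, 4, 0), (3, -1, 4), (3, 1, 0), (2, -3, -1), (1, 2, -1), (1, -8, 9)]
    (zip left_stage1 left_stage2)"
  by code_simp

lemma certified_left2:
  "certified
    [(1, -4, -3), (4, 0, -1), (3, -2, 4), (3, 4, -3), (28, -1, 11), (1, 0, -1), (0, 3, -1),
     (1, 0, 1), (1, 1, 1), (3, -3, -2), (-7, 3, -3), (-27, 13, 4)]
    (zip left_stage2 left_stage3)"
  by code_simp

definition right_stage0 :: "int3 list" where
  "right_stage0 =
    [(-3, 0, -6), (-24, 0, -12), (-24, 20, -4), (-24, 40, 4), (-24, 60, 12), (-3, 39, 6),
     (18, 18, 0), (39, -3, -6), (60, -24, -12), (45, -24, -6), (30, -24, 0), (15, -24, 6),
     (0, -24, 12), (0, -3, 6), (0, 18, 0), (0, 39, -6), (0, 60, -12), (15, 45, -6),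
     (30, 30, 0), (45, 15, 6), (60, 0, 12), (39, 0, 6), (18, 0, 0)]"

definition right_stage1 :: "int3 list" where
  "right_stage1 =
    [(-2, -1, 5), (-5, 3, 4), (-5, 9, 2), (-1, 12, 0), (5, 11, -3), (7, 5, -4), (5, -1, -4),
     (-1, -4, -3), (-5, -7, 0), (-8, -6, 5), (-7, -3, 11), (-3, 1, 12), (0, 5, 9), (2, 5, 5),
     (1, 5, 0), (-1, 4, -4), (-1, 3, -9), (1, -1, -12), (3, -6, -12), (5, -10, -8),
     (6, -11, -2), (4, -8, 3), (1, -5, 5)]"

definition right_stage2 :: "int3 list" where
  "right_stage2 =
    [(-3, -4, 3), (-5, 0, 4), (-3, 8, 2), (6, 12, 4), (14, 2, 4), (8, -5, 5), (3, -3, 6),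
     (0, -1, 4), (-3, 0, 1), (-6, 1, 0), (-8, 3, 3), (-5, 5, 7), (1, 5, 5), (1, 1, -4),
     (4, -8, -8), (-2, -17, -4), (-13, -10, -8), (-7, 4, -13), (3, 8, -8), (7, 4, -3),
     (6, 0, -1), (3, -2, 0), (0, -4, 1)]"

definition right_stage3 :: "int3 list" where
  "right_stage3 =
    [(-1, -3, 0), (-4, 0, 1), (-4, 9, 2), (8, 15, 1), (11, 1, -1), (1, -6, -4), (-3, -6, 1),
     (-1, -3, 3), (-1, 0, 1), (-3, 1, -2), (-7, 2, 0), (-6, 3, 5), (0, 4, 4), (5, 2, -7),
     (10, -9, -7), (0, -17, 3), (-14, -9, -2), (-10, 6, -9), (1, 10, -6), (6, 6, 4),
     (6, -1, 6), (4, -4, 4), (2, -4, 2)]"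

definition right_stage4 :: "int3 list" where
  "right_stage4 =
    [(0, -12, -2), (-1, -3, 0), (-12, 13, 1), (13, 15, -2), (6, 2, 0), (-1, -2, -5),
     (-4, -4, 0), (-2, -1, 3), (0, 1, 1), (-3, 1, -3), (-6, 0, 0), (-5, 2, 4), (0, 5, 2),
     (5, 3, -6), (9, -6, -1), (1, -13, 5), (-10, -5, 0), (-10, 7, -6), (0, 9, 0), (11, 9, 5),
     (5, -4, 6), (3, -6, 0), (3, -9, -2)]"

text \<open>Here seven moves lead to 5 + 14 + 4 = 23 vertices.\<close>

definition right_stage5 :: "int3 list" where
  "right_stage5 =
    [(0, -84, 0), (0, 0, 0), (-96, 96, 0), (96, 96, 0), (6, 6, 0), (0, 0, -12), (-3, 0, 0),
     (-12, 12, 12), (0, 18, 0), (-24, 24, -12), (-15, 0, 0), (-36, 36, 12), (0, 42, 0),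
     (48, 48, -12), (27, 0, 0), (0, -60, 12), (-33, 0, 0), (-72, 72, -12), (0, 78, 0),
     (84, 84, 12), (18, -20, 16), (25, -4, 0), (9, -40, -4)]"

lemma certified_right0:
  "certified
    [(0, 3, -4), (3, -1, -4), (0, 1, 3), (3, 2, 1), (-1, 2, -1), (10, 5, -12), (1, 2, 1),
     (1, 0, -3), (0, 1, 1), (1, -1, 2), (3, 0, 2)]
    (zip right_stage0 right_stage1)"
  by code_simp

lemma certified_right1:
  "certified
    [(3, -1, -4), (-3, -1, 0), (1, 4, 1), (1, 0, 2), (-3, -1, 1), (-2, -1, -1), (3, -3, -1),
     (1, -1, 2), (2, 0, -1), (1, 1, 1), (-2, -2, 1), (2, -5, -1), (1, 7, -4), (5, -8, 7)]
    (zip right_stage1 right_stage2)"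
  by code_simp

lemma certified_right2:
  "certified
    [(-1, 7, -1), (4, 1, 0), (2, -2, -3), (1, 0, 4), (1, -1, -1), (1, 2, 0), (1, 0, -1),
     (1, -1, -2), (2, 1, 1)]
    (zip right_stage2 right_stage3)"
  by code_simp

lemma certified_right3:
  "certified
    [(3, -4, 0), (4, 3, 1), (1, 1, -3), (2, 0, 3), (0, 2, 1), (4, 1, -4), (1, 1, 1),
     (-2, -2, 1), (3, -1, -2), (4, 1, 3)]
    (zip right_stage3 right_stage4)"
  by code_simp

lemma certified_right4:
  "certified
    [(1, -3, 0), (2, 0, -1), (1, 1, 4), (3, 3, -2), (4, -3, 4), (0, 1, 0), (1, -1, -1),
     (1, 0, 3), (1, 2, 0), (2, 1, 2), (2, 1, -3), (5, -1, -2), (-15, 7, 1)]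
    (zip right_stage4 right_stage5)"
  by code_simp

section \<open>The left-handed trefoil\<close>

definition left_vertices :: "int3 list" where
  "left_vertices =
    [(-24, 0, 12), (60, 0, -12), (0, 60, 12), (0, -24, -12), (60, -24, 12), (-24, 60, -12)]"

lemma left_trefoil_vertices: "left_trefoil = closed_polygon (map pt left_vertices)"
  by (simp add: left_trefoil_def trefoil_def left_vertices_def pt_def)

lemma knot_left_trefoil: "knot left_trefoil"
  unfolding left_trefoil_vertices
proof (rule certified_knot)
  show "certified
    [(2, 0, 1), (0, 2, -1), (0, 1, 3), (1, 1, 0), (1, -1, 3), (2, 1, -3), (1, 2, 3)]
    (zip left_vertices left_vertices)"
    by code_simp
qed (simp_all add: left_vertices_def)

lemma left_trefoil_stage0: "left_trefoil = closed_polygon (map pt left_stage0)"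
proof -
  \<comment> \<open>The stages are numbered along the tie curve, which runs through the trefoil
    against the order of \<open>left_vertices\<close>. After reversal, the rotation by 8 puts the
    corner \<open>(-24, 0, 12)\<close> first.\<close>
  let ?vs = "rotate 8 (rev left_stage0)"
  have "merge_edges (hd ?vs # tl ?vs @ [hd ?vs])
      = hd left_vertices # tl left_vertices @ [hd left_vertices]"
    by code_simp
  from closed_polygon_merge_edges[OF this]
  have "closed_polygon (map pt ?vs) = left_trefoil"
    by (simp add: left_trefoil_vertices left_vertices_def left_stage0_def)
  then show ?thesis
    by (simp only: rotate_map[symmetric] rev_map[symmetric] closed_polygon_rotate closed_polygon_rev)
qed

definition left_word :: "tie_move list" where
  "left_word = [(Left, In), (Right, Out), (Left, In), (Center, Out)]"

lemma tie_curve_left_word: "tie_curve left_word = closed_polygon (map pt left_stage3)"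
proof -
  have "tie_vertices left_word = map pt left_stage3"
    by (simp add: tie_vertices_def left_word_def left_stage3_def Let_def upt_rec_numeral
        crossing_def turn_def border_def region_before_eq up_def pt_def vec_eq_iff forall_3)
  then show ?thesis by (simp add: tie_curve_def)
qed

lemma tie_sequence_left_word: "tie_sequence left_word"
  unfolding tie_sequence_def
proof (intro conjI)
  show "\<exists>u. left_word = u @ [(Left, Out), (Right, In), (Center, Out)] \<or>
      left_word = u @ [(Right, Out), (Left, In), (Center, Out)]"
    by (rule exI[of _ "take 1 left_word"]) (simp add: left_word_def)
qed (auto simp: left_word_def less_Suc_eq)

lemma tie_knot_left_trefoil: "tie_knot left_trefoil"
proof -
  have "ambient_isotopic left_trefoil (closed_polygon (map pt left_stage1))"
    unfolding left_trefoil_stage0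
    by (rule certified_motion[OF _ certified_left0]) (simp add: left_stage0_def left_stage1_def)
  also have "ambient_isotopic \<dots> (closed_polygon (map pt left_stage2))"
    by (rule certified_motion[OF _ certified_left1]) (simp add: left_stage1_def left_stage2_def)
  also have "ambient_isotopic \<dots> (closed_polygon (map pt left_stage3))"
    by (rule certified_motion[OF _ certified_left2]) (simp add: left_stage2_def left_stage3_def)
  also have "closed_polygon (map pt left_stage3) = tie_curve left_word"
    by (simp only: tie_curve_left_word)
  finally have "ambient_isotopic left_trefoil (tie_curve left_word)" .
  then show ?thesis
    using knot_left_trefoil tie_sequence_left_word unfolding tie_knot_def by blast
qed

section \<open>The right-handed trefoil\<close>

definition right_vertices :: "int3 list" where
  "right_vertices =
    [(-24, 0, -12), (60, 0, 12), (0, 60, -12), (0, -24, 12), (60, -24, -12), (-24, 60, 12)]"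

lemma right_trefoil_vertices: "right_trefoil = closed_polygon (map pt right_vertices)"
  by (simp add: right_trefoil_def trefoil_def right_vertices_def pt_def)

lemma knot_right_trefoil: "knot right_trefoil"
  unfolding right_trefoil_vertices
proof (rule certified_knot)
  show "certified
    [(2, 0, 1), (0, 2, -1), (1, -1, -4), (1, 1, 0), (2, 1, 3), (1, 2, -3)]
    (zip right_vertices right_vertices)"
    by code_simp
qed (simp_all add: right_vertices_def)

lemma right_trefoil_stage0: "right_trefoil = closed_polygon (map pt right_stage0)"
proof -
  \<comment> \<open>The direction is again reversed; the corner \<open>(-24, 0, -12)\<close>, second
    in \<open>right_stage0\<close>, has index 21 in the reversed list of 23.\<close>
  let ?vs = "rotate 21 (rev right_stage0)"
  have "merge_edges (hd ?vs # tl ?vs @ [hd ?vs])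
      = hd right_vertices # tl right_vertices @ [hd right_vertices]"
    by code_simp
  from closed_polygon_merge_edges[OF this]
  have "closed_polygon (map pt ?vs) = right_trefoil"
    by (simp add: right_trefoil_vertices right_vertices_def right_stage0_def)
  then show ?thesis
    by (simp only: rotate_map[symmetric] rev_map[symmetric] closed_polygon_rotate closed_polygon_rev)
qed

definition right_word :: "tie_move list" where
  "right_word = [(Left, Out), (Center, In), (Left, Out), (Center, In),
    (Right, Out), (Left, In), (Center, Out)]"

lemma tie_curve_right_word: "tie_curve right_word = closed_polygon (map pt right_stage5)"
proof -
  have "tie_vertices right_word = map pt right_stage5"
    by (simp add: tie_vertices_def right_word_def right_stage5_def Let_def upt_rec_numeral
        crossing_def turn_def border_def region_before_eq up_def pt_def vec_eq_iff forall_3)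
  then show ?thesis by (simp add: tie_curve_def)
qed

lemma tie_sequence_right_word: "tie_sequence right_word"
  unfolding tie_sequence_def
proof (intro conjI)
  show "\<exists>u. right_word = u @ [(Left, Out), (Right, In), (Center, Out)] \<or>
      right_word = u @ [(Right, Out), (Left, In), (Center, Out)]"
    by (rule exI[of _ "take 4 right_word"]) (simp add: right_word_def)
qed (auto simp: right_word_def less_Suc_eq)

lemma tie_knot_right_trefoil: "tie_knot right_trefoil"
proof -
  have "ambient_isotopic right_trefoil (closed_polygon (map pt right_stage1))"
    unfolding right_trefoil_stage0
    by (rule certified_motion[OF _ certified_right0]) (simp add: right_stage0_def right_stage1_def)
  also have "ambient_isotopic \<dots> (closed_polygon (map pt right_stage2))"
    by (rule certified_motion[OF _ certified_right1]) (simp add: right_stage1_def right_stage2_def)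
  also have "ambient_isotopic \<dots> (closed_polygon (map pt right_stage3))"
    by (rule certified_motion[OF _ certified_right2]) (simp add: right_stage2_def right_stage3_def)
  also have "ambient_isotopic \<dots> (closed_polygon (map pt right_stage4))"
    by (rule certified_motion[OF _ certified_right3]) (simp add: right_stage3_def right_stage4_def)
  also have "ambient_isotopic \<dots> (closed_polygon (map pt right_stage5))"
    by (rule certified_motion[OF _ certified_right4]) (simp add: right_stage4_def right_stage5_def)
  also have "closed_polygon (map pt right_stage5) = tie_curve right_word"
    by (simp only: tie_curve_right_word)
  finally have "ambient_isotopic right_trefoil (tie_curve right_word)" .
  then show ?thesis
    using knot_right_trefoil tie_sequence_right_word unfolding tie_knot_def by blast
qed

theorem corollary10:
  shows "tie_knot left_trefoil \<and> tie_knot right_trefoil"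
  using tie_knot_left_trefoil tie_knot_right_trefoil by simp

end
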